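(* For all $0<\alpha<1$ there exists a constant $N_0\geq0$ such that for all $N\geq N_0$ there is a finite subset $Y\subseteq\mathbb{C}$ with $|Y|\geq N$ and a set $S$ of lines in $\mathbb{C}^2$ in general position, each $\alpha$-rich in $Y\times Y$, satisfying \[ \log|S|\approx_\alpha\sqrt{\frac{\log|Y|}{\log\log|Y|}}. \]
   Context: A line $\ell$ is $\alpha$-rich in $Y\times Y$ if $|\ell\cap(Y\times Y)|\geq\alpha|Y|$. A set of lines is in general position if no two are parallel and no three pass through a common point. $f\approx_\alpha g$ means $c^{-1}g\leq f\leq cg$ for a constant $c>0$ depending only on $\alpha$. *)

theory Defs
  imports Complex_Main
begin

definition affine_line :: "complex \<times> complex \<Rightarrow> complex \<times> complex \<Rightarrow> (complex \<times> complex) set" where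
  "affine_line p d = {(fst p + t * fst d, snd p + t * snd d) | t :: complex. True}"

(* Complex affine lines, i.e. real two-dimensional subsets; the scalar t above is complex. *)
definition is_line :: "(complex \<times> complex) set \<Rightarrow> bool" where
  "is_line l \<longleftrightarrow> (\<exists>p d. d \<noteq> (0, 0) \<and> l = affine_line p d)"

(* Equality of directions, so a line is parallel to itself. *)
definition parallel :: "(complex \<times> complex) set \<Rightarrow> (complex \<times> complex) set \<Rightarrow> bool" where
  "parallel l m \<longleftrightarrow> (\<exists>p q d. d \<noteq> (0, 0) \<and> l = affine_line p d \<and> m = affine_line q d)"

definition general_position :: "(complex \<times> complex) set set \<Rightarrow> bool" where
  "general_position S \<longleftrightarrow>
     (\<forall>l\<in>S. \<forall>m\<in>S. l \<noteq> m \<longrightarrow> \<not> parallel l m) \<and>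
     (\<forall>l\<in>S. \<forall>m\<in>S. \<forall>n\<in>S. l \<noteq> m \<and> l \<noteq> n \<and> m \<noteq> n \<longrightarrow> l \<inter> m \<inter> n = {})"

(* Used only for finite Y, where card is the true cardinality. *)
definition rich :: "real \<Rightarrow> complex set \<Rightarrow> (complex \<times> complex) set \<Rightarrow> bool" where
  "rich \<alpha> Y l \<longleftrightarrow> real (card (l \<inter> Y \<times> Y)) \<ge> \<alpha> * real (card Y)"

definition comparable :: "real \<Rightarrow> real \<Rightarrow> real \<Rightarrow> bool" where
  "comparable c f g \<longleftrightarrow> inverse c * g \<le> f \<and> f \<le> c * g"

end

theory Submission
  imports Defs "HOL-Computational_Algebra.Primes" "HOL-Library.FuncSet" "HOL-Real_Asymp.Real_Asymp"
begin

text \<open>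
  Let \<open>T\<close> be a set of \<open>k\<close> primes between \<open>k\<close> and \<open>k\<^sup>3\<close> with product \<open>P\<close>. The lines
  \<open>y = x / s + s\<close>, where \<open>s\<close> runs through the \<open>2\<^sup>k\<close> products of subsets of \<open>T\<close>, are in general
  position, since the pairs \<open>(1 / s, s)\<close> lie on a hyperbola. For \<open>Y\<close> take the fractions \<open>w / q\<close>
  whose denominators \<open>q\<close> are products of powers of the primes in \<open>T\<close> with exponents between \<open>1\<close> and
  \<open>n = m k\<close>, where \<open>m \<ge> 2 / (1 - \<alpha>)\<close>, and whose numerators are \<open>w = 1 + P z\<close> with
  \<open>0 \<le> z < m P\<^sup>n\<close>. The map \<open>x \<mapsto> x / s + s\<close> raises each exponent by at most one and moves the
  numerator by at most \<open>P\<^sup>n\<^sup>+\<^sup>1\<close>, so it keeps a proportion \<open>(1 - 1 / n)\<^sup>k (1 - 1 / m) \<ge> 1 - 2 / m\<close>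
  of \<open>Y\<close> inside \<open>Y\<close>. Finally \<open>log |Y|\<close> is of order \<open>k log P\<close>, that is, of order \<open>k\<^sup>2 log k\<close>.
\<close>

section \<open>A Chebyshev-type lower bound for the number of primes\<close>

text \<open>Leibniz's harmonic triangle has the entries \<open>1 / (Suc n * (n choose k))\<close>.
  Column \<open>0\<close> is \<open>1 / Suc n\<close>, and each later column consists of differences
  of entries of the previous one, so a common multiple \<open>D\<close> of \<open>1..N\<close>
  clears every denominator in the rows \<open>n < N\<close>.\<close>

lemma Suc_times_binomial_dvd:
  fixes D :: nat
  assumes "\<And>j. 1 \<le> j \<Longrightarrow> j \<le> N \<Longrightarrow> j dvd D" and "D > 0"
  shows "k \<le> n \<Longrightarrow> n < N \<Longrightarrow> Suc n * (n choose k) dvd D"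
proof (induction k arbitrary: n)
  case 0
  then show ?case using assms(1)[of "Suc n"] by simp
next
  case (Suc k)
  then obtain m where m: "n = Suc m" by (cases n) auto
  define a where "a = int (Suc n * (n choose k))"
  define b where "b = int (Suc m * (m choose k))"
  define c where "c = int (Suc n * (n choose Suc k))"
  have "Suc n * (n choose k) dvd D" "Suc m * (m choose k) dvd D"
    using Suc.IH[of n] Suc.IH[of m] Suc.prems m by simp_all
  then have "a dvd int D" "b dvd int D" by (simp_all only: a_def b_def int_dvd_int_iff)
  then obtain x y where x: "int D = a * x" and y: "int D = b * y" by (auto elim!: dvdE)
  have "Suc k * (n choose Suc k) = Suc m * (m choose k)"
    using binomial_absorption[of k n] m by simp
  then have "int (Suc k) * int (n choose Suc k) = int (Suc m) * int (m choose k)"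
    by (simp only: flip: of_nat_mult)
  moreover have "(n - k) * (n choose k) = Suc m * (m choose k)"
    using binomial_absorb_comp[of n k] m by simp
  then have "int (n - k) * int (n choose k) = int (Suc m) * int (m choose k)"
    by (simp only: flip: of_nat_mult)
  moreover have "int (n - k) = int m + 1 - int k" using Suc.prems m by simp
  ultimately have 1: "(int k + 1) * c = (int m + 2) * b"
    and 2: "(int m + 1 - int k) * a = (int m + 2) * b"
    unfolding a_def b_def c_def m of_nat_mult of_nat_Suc by algebra+
  \<comment> \<open>Leibniz's harmonic triangle: \<open>1/c = 1/b - 1/a\<close>.\<close>
  have "(int k + 1) * ((a - b) * c) = (int k + 1) * (a * b)"
    using 1 2 by algebra
  then have "(a - b) * c = a * b" by simp
  then have "a * b * int D = a * b * (c * (y - x))"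
    using x y by algebra
  then have "int D = c * (y - x)" using assms(2) x y by auto
  then show ?case unfolding c_def by (metis dvd_triv_left int_dvd_int_iff)
qed

text \<open>The central binomial coefficient is the largest of the \<open>2 * n + 1\<close> entries
  in its row, and its multiple by \<open>2 * n + 1\<close> divides the least common multiple of
  \<open>1..2 * n + 1\<close>, to which each prime contributes a power of at most
  \<open>2 * n + 1\<close>.\<close>

lemma four_power_le_prime_count:
  "4 ^ n \<le> (2 * n + 1) ^ card {p. prime p \<and> p \<le> 2 * n + 1}"
proof -
  define N where "N = 2 * n + 1"
  define A where "A = {p. prime p \<and> p \<le> N}"
  define f where "f p = (GREATEST i. p ^ i \<le> N)" for p
  define D where "D = (\<Prod>p\<in>A. p ^ f p)"
  have fin: "finite A" unfolding A_def by (rule finite_subset[of _ "{..N}"]) auto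
  \<comment> \<open>\<open>GREATEST\<close> is meaningful only for bounded exponents;
    \<open>i < 2 ^ i\<close> supplies the bound.\<close>
  have bnd: "i \<le> N" if "p \<ge> 2" "p ^ i \<le> N" for p i :: nat
  proof -
    have "i < 2 ^ i" by (rule less_exp)
    also have "2 ^ i \<le> p ^ i" using that by (intro power_mono) auto
    finally show ?thesis using that by simp
  qed
  have f_max: "i \<le> f p" if "p \<in> A" "p ^ i \<le> N" for p i
    unfolding f_def
  proof (rule Greatest_le_nat[where b = N])
    have "p \<ge> 2" using that by (simp add: A_def prime_ge_2_nat)
    then show "y \<le> N" if "p ^ y \<le> N" for y using bnd that by blast
  qed (use that in simp)
  have f_le: "p ^ f p \<le> N" if "p \<in> A" for p
    unfolding f_def
  proof (rule GreatestI_nat[where k = 0 and b = N])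
    have "p \<ge> 2" using that by (simp add: A_def prime_ge_2_nat)
    then show "y \<le> N" if "p ^ y \<le> N" for y using bnd that by blast
  qed (simp add: N_def)
  have "D > 0" unfolding D_def A_def by (auto intro!: prod_pos simp: prime_gt_0_nat)
  have dvd: "j dvd D" if "1 \<le> j" "j \<le> N" for j
  proof -
    have sub: "prime_factors j \<subseteq> A"
      using that unfolding A_def by (auto simp: prime_factors_dvd dest: dvd_imp_le)
    have "j = (\<Prod>p\<in>prime_factors j. p ^ multiplicity p j)"
      using prime_factorization_nat[of j] that by simp
    also have "\<dots> dvd (\<Prod>p\<in>prime_factors j. p ^ f p)"
    proof (intro prod_dvd_prod le_imp_power_dvd)
      fix p assume "p \<in> prime_factors j"
      then show "multiplicity p j \<le> f p"
        using sub that multiplicity_dvd[of p j]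
        by (intro f_max) (auto dest!: dvd_imp_le)
    qed
    also have "\<dots> dvd D" unfolding D_def using sub fin by (rule prod_dvd_prod_subset[rotated])
    finally show ?thesis .
  qed
  have "2 ^ (2 * n) = (\<Sum>k\<le>2 * n. 2 * n choose k)" by (simp add: choose_row_sum)
  also have "\<dots> \<le> (\<Sum>k\<le>2 * n. 2 * n choose n)" by (intro sum_mono binomial_maximum')
  finally have "4 ^ n \<le> (2 * n + 1) * (2 * n choose n)" by (simp add: power_mult)
  also have "Suc (2 * n) * (2 * n choose n) dvd D"
    by (rule Suc_times_binomial_dvd[OF dvd \<open>D > 0\<close>]) (auto simp: N_def)
  then have "(2 * n + 1) * (2 * n choose n) \<le> D"
    using \<open>D > 0\<close> by (intro dvd_imp_le) simp_all
  also have "D \<le> (\<Prod>p\<in>A. N)" unfolding D_def by (intro prod_mono) (auto simp: f_le)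
  also have "\<dots> = N ^ card A" by simp
  finally show ?thesis by (simp add: N_def A_def)
qed

text \<open>Once \<open>2 * k ^ 2 + 1 < 2 ^ k\<close>, having fewer than \<open>2 * k\<close> primes
  up to \<open>2 * k ^ 2 + 1\<close> would contradict \<open>four_power_le_prime_count\<close> at
  \<open>n = k ^ 2\<close>. At most \<open>k\<close> of them lie below \<open>k\<close>, so
  \<open>k\<close> remain.\<close>

lemma eventually_primes_between:
  "\<forall>\<^sub>F k in sequentially. \<exists>T. finite T \<and> card T = k \<and> (\<forall>p\<in>T. prime p \<and> k \<le> p \<and> p \<le> k ^ 3)"
proof -
  have "\<forall>\<^sub>F k in sequentially. 2 * real k ^ 2 + 1 < 2 ^ k"
    by real_asymp
  moreover have "\<forall>\<^sub>F k in sequentially. 2 * real k ^ 2 + 1 \<le> real k ^ 3"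
    by real_asymp
  ultimately show ?thesis using eventually_gt_at_top[of 0]
  proof eventually_elim
    case (elim k)
    have k: "2 * k ^ 2 + 1 < 2 ^ k" "2 * k ^ 2 + 1 \<le> k ^ 3"
      using elim(1,2) unfolding of_nat_less_iff[where 'a = real, symmetric] of_nat_le_iff[where 'a = real, symmetric]
      by simp_all
    define A where "A = {p. prime p \<and> p \<le> 2 * k ^ 2 + 1}"
    have fin: "finite A" unfolding A_def by (rule finite_subset[of _ "{..2 * k ^ 2 + 1}"]) auto
    have "2 * k \<le> card A"
    proof (rule ccontr)
      assume "\<not> ?thesis"
      then have "(2 * k ^ 2 + 1) ^ card A \<le> (2 * k ^ 2 + 1) ^ (2 * k)"
        by (intro power_increasing) auto
      also have "\<dots> < (2 ^ k) ^ (2 * k)"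
        using k elim by (intro power_strict_mono) auto
      also have "\<dots> = (2 ^ 2) ^ (k ^ 2)"
        by (simp only: power2_eq_square[of k] mult.left_commute flip: power_mult)
      finally show False using four_power_le_prime_count[of "k ^ 2"] by (simp add: A_def)
    qed
    moreover have "card A \<le> card (A - {..<k}) + k"
      using diff_card_le_card_Diff[of "{..<k}" A] by simp
    ultimately have "k \<le> card (A - {..<k})" by simp
    then obtain T where T: "T \<subseteq> A - {..<k}" "card T = k" "finite T"
      using obtain_subset_with_card_n by blast
    then have "prime p \<and> k \<le> p \<and> p \<le> k ^ 3" if "p \<in> T" for p
      using that k by (force simp: A_def)
    then show ?case using T by blast
  qed
qed

section \<open>Lines with slope \<open>1 / s\<close> and intercept \<open>s\<close>\<close>

definition hyp_line :: "complex \<Rightarrow> (complex \<times> complex) set" where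
  "hyp_line s = affine_line (0, s) (1, 1 / s)"

text \<open>At \<open>s = 0\<close> both sides describe the axis \<open>y = 0\<close>, because
  division by zero gives zero.\<close>

lemma mem_hyp_line: "(x, y) \<in> hyp_line s \<longleftrightarrow> y = x / s + s"
  by (auto simp: hyp_line_def affine_line_def)

lemma is_line_hyp_line: "is_line (hyp_line s)"
  unfolding is_line_def hyp_line_def by (intro exI[of _ "(0, s)"] exI[of _ "(1, 1 / s)"]) auto

lemma parallel_hyp_lineD:
  assumes "parallel (hyp_line s) (hyp_line t)"
  shows "s = t"
proof -
  obtain p q d where d: "d \<noteq> (0, 0)" and s: "hyp_line s = affine_line p d"
    and t: "hyp_line t = affine_line q d"
    using assms unfolding parallel_def by blast
  have on: "(fst r + c * fst d, snd r + c * snd d) \<in> affine_line r d" for r c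
    unfolding affine_line_def by blast
  have slope: "snd d = fst d / r" if "hyp_line r = affine_line o' d" for r o'
    using on[of o' 0] on[of o' 1] unfolding that[symmetric] mem_hyp_line
    by (simp add: add_divide_distrib)
  have "fst d / s = fst d / t" using slope[OF s] slope[OF t] by (rule trans[OF sym])
  moreover have "fst d \<noteq> 0" using d slope[OF s] by (cases d) auto
  \<comment> \<open>\<open>inverse\<close> is injective on all complex numbers, with
    \<open>inverse 0 = 0\<close>, so a zero parameter is covered too.\<close>
  ultimately show ?thesis unfolding divide_inverse by auto
qed

text \<open>The parameters of the lines through \<open>(x, y)\<close> are roots of the quadratic
  \<open>s * s - y * s + x\<close>, so at most two of the lines meet there;
  \<open>0 \<notin> A\<close> permits multiplying the line equation by \<open>s\<close>.\<close>

lemma general_position_hyp_lines: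
  assumes "0 \<notin> A"
  shows "general_position (hyp_line ` A)"
  unfolding general_position_def
proof (intro conjI ballI impI)
  fix l m n assume lmn: "l \<in> hyp_line ` A" "m \<in> hyp_line ` A" "n \<in> hyp_line ` A"
    "l \<noteq> m \<and> l \<noteq> n \<and> m \<noteq> n"
  then obtain r s t where rst: "l = hyp_line r" "m = hyp_line s" "n = hyp_line t"
      "r \<in> A" "s \<in> A" "t \<in> A" "r \<noteq> s" "r \<noteq> t" "s \<noteq> t" by blast
  show "l \<inter> m \<inter> n = {}"
  proof (rule ccontr)
    assume "l \<inter> m \<inter> n \<noteq> {}"
    then obtain x y where "(x, y) \<in> l" "(x, y) \<in> m" "(x, y) \<in> n" by auto
    moreover have "y * a = x + a * a" if "(x, y) \<in> hyp_line a" "a \<in> A" for a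
      using that assms by (auto simp: mem_hyp_line distrib_right)
    ultimately have "y * r = x + r * r" "y * s = x + s * s" "y * t = x + t * t"
      using rst by blast+
    then have "(y - r - s) * (r - s) = 0" "(y - r - t) * (r - t) = 0"
      by algebra+
    then show False using rst by auto
  qed
qed (use parallel_hyp_lineD in blast)

lemma inj_hyp_line: "inj hyp_line"
proof (rule injI)
  fix s t assume "hyp_line s = hyp_line t"
  then have "(0, s) \<in> hyp_line t" using mem_hyp_line[of 0 s s] by simp
  then show "s = t" by (simp add: mem_hyp_line)
qed

section \<open>Fractions with denominators composed of the primes in \<open>T\<close>, and their
  rich lines\<close>

text \<open>
  Numerators are restricted to the class of \<open>1\<close> modulo \<open>P\<close>, so that every fraction is in lowest
  terms and determines its index, while \<open>x \<mapsto> x / s + s\<close> still preserves this form because all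
  denominators are multiples of \<open>P\<close>.
\<close>

locale prime_grid =
  fixes T :: "nat set" and n m :: nat
  assumes fin: "finite T" and pr: "\<And>p. p \<in> T \<Longrightarrow> prime p" and n_pos: "n > 0" and m_pos: "m > 0"
begin

definition P :: nat where "P = \<Prod>T"
definition Q :: "(nat \<Rightarrow> nat) \<Rightarrow> nat" where "Q u = (\<Prod>p\<in>T. p ^ u p)"
definition pt :: "(nat \<Rightarrow> nat) \<times> nat \<Rightarrow> complex" where
  "pt = (\<lambda>(u, z). of_nat (1 + P * z) / of_nat (Q u))"
text \<open>Exponents start at \<open>1\<close> so that \<open>P\<close> divides every denominator.
  The bounds are parameters because both the full grid and a slightly smaller one are
  counted.\<close>

definition idx :: "nat \<Rightarrow> nat \<Rightarrow> ((nat \<Rightarrow> nat) \<times> nat) set" where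
  "idx N Z = (T \<rightarrow>\<^sub>E {1..N}) \<times> {..<Z}"
definition Y :: "complex set" where "Y = pt ` idx n (m * P ^ n)"

lemma P_pos: "P > 0" unfolding P_def using pr by (auto intro!: prod_pos simp: prime_gt_0_nat)
lemma Q_pos: "Q u > 0" unfolding Q_def using pr by (auto intro!: prod_pos simp: prime_gt_0_nat)

lemma finite_idx: "finite (idx N Z)"
  unfolding idx_def using fin by (intro finite_SigmaI finite_PiE) auto

lemma card_idx: "card (idx N Z) = N ^ card T * Z"
  unfolding idx_def using fin by (simp add: card_cartesian_product card_PiE)

lemma multiplicity_Q: "q \<in> T \<Longrightarrow> multiplicity q (Q u) = u q"
  unfolding Q_def using fin pr by (subst multiplicity_prod_prime_powers) auto

lemma P_dvd_Q: "(\<And>p. p \<in> T \<Longrightarrow> 1 \<le> u p) \<Longrightarrow> P dvd Q u"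
  unfolding P_def Q_def by (intro prod_dvd_prod) (auto intro!: dvd_power simp: Suc_le_eq)

lemma Q_le: "(\<And>p. p \<in> T \<Longrightarrow> u p \<le> N) \<Longrightarrow> Q u \<le> P ^ N"
  unfolding P_def Q_def prod_power_distrib
  using pr by (intro prod_mono) (auto intro!: power_increasing simp: prime_gt_0_nat Suc_leI)

lemma coprime_Q: "coprime (1 + P * z) (Q u)"
proof -
  have "coprime (1 + P * z) (p ^ u p)" if "p \<in> T" for p
  proof -
    have "p dvd P" unfolding P_def using that fin by (auto intro: dvd_prodI[where f = "\<lambda>x. x", simplified])
    have "coprime (1 + P * z) p"
    proof (rule coprimeI)
      fix c assume c: "c dvd 1 + P * z" "c dvd p"
      then have "c dvd P * z" using \<open>p dvd P\<close> by (blast intro: dvd_trans dvd_mult2)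
      then show "is_unit c" using c(1) by (simp only: dvd_add_left_iff)
    qed
    then show ?thesis by simp
  qed
  then show ?thesis unfolding Q_def by (intro prod_coprime_right) auto
qed

lemma inj_pt: "inj_on pt (idx N Z)"
proof (rule inj_onI)
  fix a b assume a: "a \<in> idx N Z" and b: "b \<in> idx N Z" and eq: "pt a = pt b"
  obtain u z v w where ab: "a = (u, z)" "b = (v, w)" by fastforce
  have "(of_nat ((1 + P * z) * Q v) :: complex) = of_nat ((1 + P * w) * Q u)"
    using eq Q_pos[of u] Q_pos[of v] unfolding ab pt_def by (simp add: field_simps)
  then have e: "(1 + P * z) * Q v = (1 + P * w) * Q u" by (simp only: of_nat_eq_iff)
  have "Q u dvd (1 + P * z) * Q v" "Q v dvd (1 + P * w) * Q u" 
    using dvd_triv_right[of "Q u"] dvd_triv_right[of "Q v"] e by metis+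
  then have "Q u dvd Q v" "Q v dvd Q u"
    using coprime_Q coprime_commute coprime_dvd_mult_right_iff by blast+
  then have Q: "Q u = Q v" by (rule dvd_antisym)
  then have "u p = v p" if "p \<in> T" for p using multiplicity_Q that by metis
  \<comment> \<open>\<open>PiE\<close> fixes the value \<open>undefined\<close> outside
    \<open>T\<close>, so agreement on \<open>T\<close> suffices.\<close>
  then have "u = v" using a b unfolding ab idx_def by (auto intro: PiE_ext)
  moreover have "z = w" using e Q Q_pos[of v] P_pos by simp
  ultimately show "a = b" by (simp add: ab)
qed

lemma card_Y: "card Y = n ^ card T * (m * P ^ n)"
  unfolding Y_def by (simp add: card_image inj_pt card_idx)

lemma rich_hyp_line:
  assumes I: "I \<subseteq> T" and \<alpha>: "\<alpha> * (real n ^ card T * m) \<le> real (n - 1) ^ card T * (m - 1)"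
  shows "rich \<alpha> Y (hyp_line (of_nat (\<Prod>I)))"
proof -
  define s where "s = \<Prod>I"
  define g where "g = (\<lambda>x::complex. (x, x / of_nat s + of_nat s))"
  \<comment> \<open>One exponent less leaves room for another factor of each prime in
    \<open>I\<close>; \<open>m - 1\<close> in place of \<open>m\<close> leaves room to shift
    \<open>z\<close> by up to \<open>P ^ n\<close>.\<close>
  define J where "J = idx (n - 1) ((m - 1) * P ^ n)"
  have "s dvd P" unfolding s_def P_def using I fin by (rule prod_dvd_prod_subset[rotated])
  then have s: "s > 0" "s \<le> P" using P_pos by (auto intro: dvd_imp_le gr0I)
  have J: "J \<subseteq> idx n (m * P ^ n)"
    unfolding J_def idx_def by (intro Sigma_mono PiE_mono) auto
  have "g (pt a) \<in> hyp_line (of_nat s) \<inter> Y \<times> Y" if "a \<in> J" for a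
  proof -
    obtain u z where a: "a = (u, z)" by fastforce
    define v where "v = restrict (\<lambda>p. if p \<in> I then Suc (u p) else u p) T"
    have u: "1 \<le> u p" "u p \<le> n - 1" if "p \<in> T" for p
      using \<open>a \<in> J\<close> that unfolding a J_def idx_def by (auto dest: PiE_mem)
    have v: "v p \<in> {1..n}" if "p \<in> T" for p
      using u[OF that] n_pos that unfolding v_def by auto
    have Qv: "Q v = Q u * s"
    proof -
      have "Q v = (\<Prod>p\<in>T. p ^ u p * (if p \<in> I then p else 1))"
        unfolding Q_def by (intro prod.cong) (auto simp: v_def)
      also have "\<dots> = Q u * (\<Prod>p\<in>T. if p \<in> I then p else 1)"
        by (simp add: Q_def prod.distrib)
      also have "(\<Prod>p\<in>T. if p \<in> I then p else 1) = s"
        unfolding s_def using fin I by (subst prod.inter_restrict[symmetric]) (auto simp: Int_absorb1)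
      finally show ?thesis .
    qed
    \<comment> \<open>Over the denominator \<open>Q v = Q u * s\<close>, adding \<open>s\<close>
      adds \<open>s * Q v = P * (s * r)\<close> to the numerator, so \<open>z\<close> moves to
      \<open>z + s * r\<close>.\<close>
    obtain r where r: "Q v = P * r" using P_dvd_Q[of v] v by auto
    have "P * (s * r) \<le> P * P ^ n"
      using Q_le[of v n] v s mult_mono[of s P "Q v" "P ^ n"] r by (auto simp: mult.left_commute)
    then have "s * r \<le> P ^ n" using P_pos by simp
    moreover have "z < (m - 1) * P ^ n" using that unfolding a J_def idx_def by simp
    ultimately have "z + s * r < (m - 1) * P ^ n + P ^ n" by simp
    also have "\<dots> = m * P ^ n" using m_pos by (cases m) auto
    finally have "(v, z + s * r) \<in> idx n (m * P ^ n)"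
      using v unfolding idx_def v_def by (auto simp: PiE_def)
    moreover have "pt (v, z + s * r) = snd (g (pt a))"
    proof -
      have "(of_nat (1 + P * (z + s * r)) :: complex) = of_nat (1 + P * z) + of_nat s * of_nat (Q v)"
        unfolding r by (simp add: algebra_simps)
      then show ?thesis unfolding pt_def g_def a
        using s Q_pos[of u] by (simp add: Qv field_simps)
    qed
    ultimately have "snd (g (pt a)) \<in> Y" unfolding Y_def by (metis imageI)
    moreover have "fst (g (pt a)) \<in> Y" using that J unfolding Y_def g_def by auto
    ultimately show ?thesis by (auto simp: g_def mem_hyp_line)
  qed
  then have "(g \<circ> pt) ` J \<subseteq> hyp_line (of_nat s) \<inter> Y \<times> Y"
    unfolding image_subset_iff comp_apply by blast
  moreover have "finite Y" unfolding Y_def by (simp add: finite_idx)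
  ultimately have "card ((g \<circ> pt) ` J) \<le> card (hyp_line (of_nat s) \<inter> Y \<times> Y)"
    by (intro card_mono) auto
  moreover have "inj_on (g \<circ> pt) J"
    unfolding J_def using inj_pt by (intro comp_inj_on) (auto simp: g_def inj_on_def)
  ultimately have le: "(n - 1) ^ card T * ((m - 1) * P ^ n) \<le> card (hyp_line (of_nat s) \<inter> Y \<times> Y)"
    by (simp only: card_image card_idx J_def)
  have "\<alpha> * real (card Y) = \<alpha> * (real n ^ card T * m) * real P ^ n"
    by (simp add: card_Y)
  also have "\<dots> \<le> (real (n - 1) ^ card T * (m - 1)) * real P ^ n"
    using \<alpha> by (intro mult_right_mono) auto
  also have "\<dots> = real ((n - 1) ^ card T * ((m - 1) * P ^ n))" using m_pos by simp
  also have "\<dots> \<le> real (card (hyp_line (of_nat s) \<inter> Y \<times> Y))"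
    using le by (simp only: of_nat_le_iff)
  finally show ?thesis by (simp add: rich_def s_def)
qed

text \<open>\<open>I\<close> is recovered as the set of primes in \<open>T\<close> that divide its
  product.\<close>

lemma inj_on_prod_subsets: "inj_on (\<lambda>I. \<Prod>I) (Pow T)"
proof (rule inj_onI)
  fix I J assume IJ: "I \<in> Pow T" "J \<in> Pow T" and eq: "\<Prod>I = \<Prod>J"
  have *: "K = {p\<in>T. p dvd \<Prod>K}" if K: "K \<in> Pow T" for K
  proof -
    have "finite K" using K fin finite_subset by blast
    moreover have "p \<in> K" if p: "p \<in> T" "p dvd \<Prod>K" for p
    proof -
      have "\<exists>q\<in>K. p dvd q"
        using p(2) unfolding prime_dvd_prod_iff[OF \<open>finite K\<close> pr[OF p(1)]] .
      then show ?thesis using K pr p(1) primes_dvd_imp_eq by (metis PowD subsetD)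
    qed
    moreover have "p dvd \<Prod>K" if "p \<in> K" for p
      using dvd_prodI[OF \<open>finite K\<close> that, of "\<lambda>x. x"] .
    ultimately show ?thesis using K by blast
  qed
  have "I = {p\<in>T. p dvd \<Prod>I}" by (rule *[OF IJ(1)])
  also have "\<dots> = J" unfolding eq by (rule *[OF IJ(2), symmetric])
  finally show "I = J" .
qed

definition S :: "(complex \<times> complex) set set" where
  "S = hyp_line ` (\<lambda>I. of_nat (\<Prod>I)) ` Pow T"

lemma card_S: "card S = 2 ^ card T"
proof -
  have "inj_on (\<lambda>I. of_nat (\<Prod>I) :: complex) (Pow T)"
    using inj_on_prod_subsets unfolding inj_on_def of_nat_eq_iff .
  then show ?thesis unfolding S_def using fin inj_hyp_line
    by (simp add: card_image card_Pow inj_on_subset)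
qed

lemma general_position_S: "general_position S"
  unfolding S_def
proof (rule general_position_hyp_lines)
  have "(0 :: complex) \<noteq> of_nat (\<Prod>I)" if "I \<in> Pow T" for I
  proof -
    have "\<Prod>I > 0" using that pr by (auto intro!: prod_pos simp: prime_gt_0_nat)
    then show ?thesis unfolding of_nat_0_eq_iff by simp
  qed
  then show "0 \<notin> (\<lambda>I. of_nat (\<Prod>I) :: complex) ` Pow T" by blast
qed

end

section \<open>Asymptotic size of the grid\<close>

text \<open>Meant for \<open>X = ln (card Y)\<close> and \<open>lP = ln P\<close>. With
  \<open>L = ln k\<close>, \<open>X\<close> lies between \<open>m * k ^ 2 * L\<close> and
  \<open>6 * m * k ^ 2 * L\<close>, and \<open>ln X\<close> between \<open>L\<close> and
  \<open>5 * L\<close>, so \<open>X / ln X\<close> is of order \<open>k ^ 2\<close>.\<close>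

lemma comparable_growth:
  fixes k m lP :: real
  assumes k: "k \<ge> 3" "k \<ge> m" and m: "m \<ge> 2" and k6: "6 * m \<le> k ^ 2"
    and lP: "k * ln k \<le> lP" "lP \<le> 3 * k * ln k"
    and X: "X = k * ln (m * k) + ln m + m * k * lP"
  shows "comparable (6 * m) (k * ln 2) (sqrt (X / ln X))"
proof -
  define L where "L = ln k"
  have L: "1 \<le> L" "L \<le> k"
    unfolding L_def using k ln_ge_iff[of k 1] exp_le ln_bound[of k] by auto
  have lm: "0 \<le> ln m" "ln m \<le> L" using m k by (auto simp: L_def)
  have lmk: "ln (m * k) = ln m + L" using m k by (simp add: L_def ln_mult)
  have "m * k * lP \<ge> m * k * (k * L)" using lP(1) m k unfolding L_def by (intro mult_left_mono) auto
  moreover have "k * ln (m * k) \<ge> 0" using lm lmk k L by simp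
  ultimately have X_ge: "X \<ge> m * k ^ 2 * L"
    using lm unfolding X by (simp add: power2_eq_square mult_ac)
  have "m * k * lP \<le> m * k * (3 * k * L)" using lP(2) m k unfolding L_def by (intro mult_left_mono) auto
  moreover have "k * ln (m * k) \<le> k * (2 * L)" using lm lmk k by (intro mult_left_mono) auto
  moreover have "k * L \<le> k\<^sup>2 * L" "L \<le> k\<^sup>2 * L" "1 * (k\<^sup>2 * L) \<le> m * (k\<^sup>2 * L)"
    using mult_right_mono[of k "k\<^sup>2" L] mult_right_mono[of 1 "k\<^sup>2" L]
      mult_right_mono[of 1 m "k\<^sup>2 * L"] mult_mono[of 1 k 1 k] mult_mono[of 1 k k k] k L m
    by (auto simp: power2_eq_square)
  \<comment> \<open>The factor is 6 = 3 + 2 + 1, from \<open>m * k * lP\<close>,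
    \<open>k * ln (m * k)\<close> and \<open>ln m\<close> in turn.\<close>
  ultimately have X_le: "X \<le> 6 * m * k ^ 2 * L"
    using lm unfolding X by (simp add: power2_eq_square mult_ac)
  have "1 * (1 * k) * 1 \<le> m * (k * k) * L" using m k L by (intro mult_mono) auto
  then have "k \<le> X" using X_ge by (simp add: power2_eq_square)
  have lnX_ge: "L \<le> ln X" unfolding L_def using \<open>k \<le> X\<close> k by simp
  have lnX_le: "ln X \<le> 5 * L"
  proof -
    have "6 * m * k ^ 2 * L \<le> k ^ 2 * k ^ 2 * k"
      using k6 L k m by (intro mult_mono) auto
    then have "X \<le> k ^ 5" using X_le by (simp add: power_numeral_reduce mult_ac)
    then have "ln X \<le> ln (k ^ 5)" using \<open>k \<le> X\<close> k by simp
    then show ?thesis using k by (simp add: ln_realpow L_def)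
  qed
  have "X / ln X \<le> (6 * m * k ^ 2 * L) / L"
    using X_le lnX_ge L m by (intro frac_le) auto
  also have "\<dots> = 6 * m * k\<^sup>2" using L by simp
  also have "\<dots> \<le> (3 * m * k) ^ 2"
    using m k by (simp add: power2_eq_square)
  finally have up: "sqrt (X / ln X) \<le> 3 * m * k"
    using m k by (intro real_le_lsqrt) auto
  have "(k / 3) ^ 2 \<le> m * k ^ 2 / 5"
    using mult_right_mono[of 1 "m * (9 / 5)" "k\<^sup>2"] m by (simp add: power_divide)
  also have "\<dots> = (m * k ^ 2 * L) / (5 * L)" using L by simp
  also have "\<dots> \<le> X / ln X"
    using X_ge lnX_le lnX_ge L \<open>k \<le> X\<close> k by (intro frac_le) auto
  finally have lo: "k / 3 \<le> sqrt (X / ln X)" by (rule real_le_rsqrt)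
  have "inverse (6 * m) * sqrt (X / ln X) \<le> inverse (6 * m) * (3 * m * k)"
    using up m by (intro mult_left_mono) auto
  also have "\<dots> = k * (1 / 2)" using m by (simp add: field_simps)
  \<comment> \<open>\<open>ln 2 \<ge> 1 / 2\<close> follows from \<open>ln x \<le> x - 1\<close> at
    \<open>x = 1 / 2\<close>.\<close>
  also have "\<dots> \<le> k * ln 2"
    using k ln_le_minus_one[of "1 / 2 :: real"] ln_inverse[of "2 :: real"] by (intro mult_left_mono) auto
  finally have 1: "inverse (6 * m) * sqrt (X / ln X) \<le> k * ln 2" .
  have "k * ln 2 \<le> k * 1" using k ln_le_minus_one[of "2::real"] by (intro mult_left_mono) auto
  also have "\<dots> \<le> 6 * 1 * (k / 3)" using k by simp
  also have "\<dots> \<le> 6 * m * sqrt (X / ln X)"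
    using lo m k by (intro mult_mono) auto
  finally show ?thesis using 1 by (simp add: comparable_def)
qed

section \<open>Choice of parameters for a given \<open>\<alpha>\<close>\<close>

theorem theorem2p9:
  fixes \<alpha> :: real
  assumes "0 < \<alpha>" and "\<alpha> < 1"
  shows "\<exists>c > 0. \<exists>N0 :: nat. \<forall>N \<ge> N0.
           \<exists>(Y :: complex set) (S :: (complex \<times> complex) set set).
             finite Y \<and> card Y \<ge> N \<and>
             finite S \<and> (\<forall>l\<in>S. is_line l) \<and> general_position S \<and>
             (\<forall>l\<in>S. rich \<alpha> Y l) \<and>
             comparable c (ln (real (card S)))
               (sqrt (ln (real (card Y)) / ln (ln (real (card Y)))))"
proof -
  define m where "m = nat \<lceil>2 / (1 - \<alpha>)\<rceil>"
  have "2 / (1 - \<alpha>) \<le> real m" unfolding m_def by linarith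
  then have m\<alpha>: "2 \<le> (1 - \<alpha>) * m" using assms by (simp add: field_simps)
  moreover have "(1 - \<alpha>) * real m \<le> 1 * real m" using assms by (intro mult_right_mono) auto
  ultimately have m: "m \<ge> 2" by simp
  \<comment> \<open>The number \<open>k\<close> of primes doubles as the lower bound for
    \<open>card Y\<close>, so a threshold for \<open>k\<close> serves as \<open>N0\<close>.\<close>
  let ?good = "\<lambda>k. \<exists>(Y :: complex set) (S :: (complex \<times> complex) set set).
             finite Y \<and> card Y \<ge> k \<and>
             finite S \<and> (\<forall>l\<in>S. is_line l) \<and> general_position S \<and>
             (\<forall>l\<in>S. rich \<alpha> Y l) \<and>
             comparable (6 * real m) (ln (real (card S)))
               (sqrt (ln (real (card Y)) / ln (ln (real (card Y)))))"
  have "\<forall>\<^sub>F k in sequentially. 6 * real m \<le> real k ^ 2" by real_asymp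
  then have "\<forall>\<^sub>F k in sequentially. ?good k"
    using eventually_primes_between eventually_ge_at_top[of 3] eventually_ge_at_top[of m]
  proof eventually_elim
    case (elim k)
    then obtain T where T: "finite T" "card T = k" and pT: "\<And>p. p \<in> T \<Longrightarrow> prime p"
      and lo: "\<And>p. p \<in> T \<Longrightarrow> k \<le> p" and hi: "\<And>p. p \<in> T \<Longrightarrow> p \<le> k ^ 3" by blast
    interpret prime_grid T "m * k" m
      by unfold_locales (use T pT m elim in auto)
    have "finite Y" unfolding Y_def by (simp add: finite_idx)
    have "finite S" unfolding S_def using T by simp
    have cY: "card Y = (m * k) ^ k * (m * P ^ (m * k))" using card_Y T by simp
    have "k < 2 ^ k" by (rule less_exp)
    also have "\<dots> \<le> (m * k) ^ k * 1" using mult_le_mono[of 2 m 1 k] m elim by (auto intro!: power_mono)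
    also have "\<dots> \<le> card Y" unfolding cY using m P_pos by (intro mult_left_mono) auto
    finally have kY: "k \<le> card Y" by simp
    have \<alpha>: "\<alpha> * (real (m * k) ^ card T * m) \<le> real (m * k - 1) ^ card T * (m - 1)"
    proof -
      define t where "t = 1 / real m"
      have t: "0 \<le> t" "t \<le> 1" using m by (auto simp: t_def)
      have "\<alpha> \<le> 1 - 2 * t" using m\<alpha> m by (simp add: t_def field_simps)
      also have "\<dots> \<le> (1 - t) * (1 - t)" by (simp add: algebra_simps)
      \<comment> \<open>Bernoulli's inequality: with \<open>n = m * k\<close>, each of the
        \<open>k\<close> primes costs a proportion \<open>t / k = 1 / n\<close>, at most
        \<open>t\<close> altogether.\<close>
      also have "1 - t \<le> (1 - t / k) ^ k"
        using Bernoulli_inequality[of "- t / k" k] t elim by (simp add: field_simps)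
      then have "(1 - t) * (1 - t) \<le> (1 - t / k) ^ k * (1 - t)"
        using t by (intro mult_right_mono) auto
      finally have "\<alpha> * (real (m * k) ^ k * m) \<le> (1 - t / k) ^ k * (1 - t) * (real (m * k) ^ k * m)"
        by (intro mult_right_mono) auto
      also have "\<dots> = ((1 - t / k) * real (m * k)) ^ k * ((1 - t) * m)"
        by (simp add: power_mult_distrib)
      also have "(1 - t / k) * real (m * k) = real (m * k - 1)"
        using m elim by (subst of_nat_diff) (auto simp: t_def field_simps)
      also have "(1 - t) * m = real (m - 1)"
        using m by (simp add: t_def field_simps of_nat_diff)
      finally show ?thesis using T m by simp
    qed
    have "rich \<alpha> Y l" if "l \<in> S" for l
      using that rich_hyp_line[OF _ \<alpha>] unfolding S_def by auto
    moreover have "is_line l" if "l \<in> S" for l using that is_line_hyp_line unfolding S_def by auto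
    moreover have "comparable (6 * real m) (ln (real (card S))) (sqrt (ln (real (card Y)) / ln (ln (real (card Y)))))"
    proof -
      have "k ^ k \<le> P" unfolding P_def T(2)[symmetric] prod_constant[symmetric]
        using lo T by (intro prod_mono) auto
      then have "ln (real (k ^ k)) \<le> ln (real P)" using elim P_pos by (subst ln_le_cancel_iff) (auto simp del: of_nat_power)
      moreover have "P \<le> (k ^ 3) ^ k" unfolding P_def T(2)[symmetric] prod_constant[symmetric]
        using hi T by (intro prod_mono) auto
      then have "ln (real P) \<le> ln (real ((k ^ 3) ^ k))" using elim P_pos by (subst ln_le_cancel_iff) (auto simp del: of_nat_power)
      moreover have "ln (real (card Y)) = k * ln (real m * k) + ln m + m * k * ln P"
        unfolding cY using m elim P_pos by (simp add: ln_mult ln_realpow)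
      ultimately have "comparable (6 * real m) (k * ln 2) (sqrt (ln (real (card Y)) / ln (ln (real (card Y)))))"
        using elim m by (intro comparable_growth) (auto simp: ln_realpow)
      then show ?thesis using T by (simp add: card_S ln_realpow)
    qed
    ultimately show ?case using \<open>finite Y\<close> \<open>finite S\<close> kY general_position_S by blast
  qed
  then show ?thesis
    unfolding eventually_sequentially using m by (intro exI[of _ "6 * real m"]) auto
qed

end
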